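(* Let $\mathcal{M}_2$ be a general rotational surface of hyperbolic type in $\mathbb{E}^4_2$ with plane meridian curve $m$, i.e. the Lorentz surface $$z(u,v)=\left(f(u)\cosh\alpha v,\ g(u)\cosh\beta v,\ f(u)\sinh\alpha v,\ g(u)\sinh\beta v\right),\quad u\in J,\ v\in[0,2\pi),$$ where $\alpha,\beta$ are positive constants and $f,g$ are smooth functions on $J$ with $\alpha^2f^2+\beta^2g^2>0$ and $f'^2+g'^2>0$. Then $\mathcal{M}_2$ has parallel normalized mean curvature vector field if and only if, up to a change of the parameter $u$ (the meridian curve $m$ being regarded as the plane curve traced by the points $(f,g)$), $m$ is determined by $$f(u)=\pm\sqrt{C^2-u^2},\qquad g(u)=u,\qquad C=const\neq0.$$
   Context: $\mathbb{E}^4_2$ is $\mathbb{R}^4$ with the metric $dx_1^2+dx_2^2-dx_3^2-dx_4^2$. $J\subset\mathbb{R}$ is an interval. The meridian curve $m$ is the plane curve $u\mapsto(f(u),g(u),0,0)$. A surface in $\mathbb{E}^4_2$ is Lorentz if its induced metric has signature $(1,1)$; here the first fundamental form is $E=f'^2+g'^2>0$, $F=0$, $G=-(\alpha^2f^2+\beta^2g^2)<0$. With $\sigma$ the second fundamental form and $D$ the normal connection, the mean curvature vector field is $H=\frac12\operatorname{tr}\sigma$. A normal vector field $\xi$ is parallel if $D\xi=0$ identically. The surface has parallel normalized mean curvature vector field if $H$ is non-zero and there exists a unit vector field in the direction of $H$ (that is, $\langle\xi,\xi\rangle=\pm1$) which is parallel in the normal bundle. *)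

theory Defs
  imports "HOL-Analysis.Analysis"
begin

text \<open>
  Derivatives are taken within the parameter sets, so that half-open or closed parameter
  intervals are covered (with one-sided derivatives at end points that belong to them).
\<close>

subsection \<open>Smooth maps of one and of two real parameters\<close>

definition smooth1 :: "real set \<Rightarrow> (real \<Rightarrow> 'a::real_normed_vector) \<Rightarrow> bool" where
  "smooth1 S f \<longleftrightarrow>
     (\<exists>D :: nat \<Rightarrow> real \<Rightarrow> 'a. D 0 = f \<and>
        (\<forall>n. \<forall>u\<in>S. (D n has_vector_derivative D (Suc n) u) (at u within S)))"

text \<open>
  In two parameters \<open>D i j\<close> is the partial derivative of order \<open>i\<close> in the first and \<open>j\<close> in the
  second parameter; the map is \<open>C\<^sup>\<infinity>\<close> iff these all exist and are (jointly) continuous.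
\<close>

definition smooth2 ::
    "real set \<Rightarrow> real set \<Rightarrow> (real \<Rightarrow> real \<Rightarrow> 'a::real_normed_vector) \<Rightarrow> bool" where
  "smooth2 S T f \<longleftrightarrow>
     (\<exists>D :: nat \<Rightarrow> nat \<Rightarrow> real \<Rightarrow> real \<Rightarrow> 'a. D 0 0 = f \<and>
        (\<forall>i j. continuous_on (S \<times> T) (\<lambda>(u, v). D i j u v) \<and>
          (\<forall>u\<in>S. \<forall>v\<in>T.
             ((\<lambda>s. D i j s v) has_vector_derivative D (Suc i) j u v) (at u within S) \<and>
             ((\<lambda>t. D i j u t) has_vector_derivative D i (Suc j) u v) (at v within T))))"

definition pd1 ::
    "real set \<Rightarrow> (real \<Rightarrow> real \<Rightarrow> 'a::real_normed_vector) \<Rightarrow> real \<Rightarrow> real \<Rightarrow> 'a" where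
  "pd1 S z u v = vector_derivative (\<lambda>s. z s v) (at u within S)"

definition pd2 ::
    "real set \<Rightarrow> (real \<Rightarrow> real \<Rightarrow> 'a::real_normed_vector) \<Rightarrow> real \<Rightarrow> real \<Rightarrow> 'a" where
  "pd2 T z u v = vector_derivative (\<lambda>t. z u t) (at v within T)"

subsection \<open>Parametrised surfaces in the pseudo-Euclidean space of signature (2,2)\<close>

definition pdot :: "real^4 \<Rightarrow> real^4 \<Rightarrow> real" where
  "pdot x y = x$1 * y$1 + x$2 * y$2 - x$3 * y$3 - x$4 * y$4"

context
  fixes S T :: "real set" and z :: "real \<Rightarrow> real \<Rightarrow> real^4"
begin

definition fff_E :: "real \<Rightarrow> real \<Rightarrow> real" where
  "fff_E u v = pdot (pd1 S z u v) (pd1 S z u v)"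

definition fff_F :: "real \<Rightarrow> real \<Rightarrow> real" where
  "fff_F u v = pdot (pd1 S z u v) (pd2 T z u v)"

definition fff_G :: "real \<Rightarrow> real \<Rightarrow> real" where
  "fff_G u v = pdot (pd2 T z u v) (pd2 T z u v)"

definition tangent_plane :: "real \<Rightarrow> real \<Rightarrow> (real^4) set" where
  "tangent_plane u v = span {pd1 S z u v, pd2 T z u v}"

definition normal_plane :: "real \<Rightarrow> real \<Rightarrow> (real^4) set" where
  "normal_plane u v = {n. \<forall>x\<in>tangent_plane u v. pdot n x = 0}"

text \<open>
  The normal component of a vector; it exists and is unique because the induced metric of a
  Lorentz surface is nondegenerate.
\<close>

definition normal_part :: "real \<Rightarrow> real \<Rightarrow> real^4 \<Rightarrow> real^4" where
  "normal_part u v w = (THE n. n \<in> normal_plane u v \<and> w - n \<in> tangent_plane u v)"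

text \<open>
  The second fundamental form on the coordinate fields, by the Gauss formula: the normal part of
  the flat derivative of one coordinate field along the other.
\<close>

definition sff_11 :: "real \<Rightarrow> real \<Rightarrow> real^4" where
  "sff_11 u v = normal_part u v (pd1 S (pd1 S z) u v)"

definition sff_12 :: "real \<Rightarrow> real \<Rightarrow> real^4" where
  "sff_12 u v = normal_part u v (pd1 S (pd2 T z) u v)"

definition sff_22 :: "real \<Rightarrow> real \<Rightarrow> real^4" where
  "sff_22 u v = normal_part u v (pd2 T (pd2 T z) u v)"

text \<open>
  Half the trace of the second fundamental form with respect to the induced metric; the
  coefficients are the entries of the inverse of the matrix with rows \<open>E, F\<close> and \<open>F, G\<close>.
\<close>

definition mean_curvature_vector :: "real \<Rightarrow> real \<Rightarrow> real^4" where
  "mean_curvature_vector u v =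
     (1/2) *\<^sub>R (1 / (fff_E u v * fff_G u v - (fff_F u v)\<^sup>2)) *\<^sub>R
       (fff_G u v *\<^sub>R sff_11 u v - (2 * fff_F u v) *\<^sub>R sff_12 u v + fff_E u v *\<^sub>R sff_22 u v)"

definition normal_field :: "(real \<Rightarrow> real \<Rightarrow> real^4) \<Rightarrow> bool" where
  "normal_field \<xi> \<longleftrightarrow> smooth2 S T \<xi> \<and> (\<forall>u\<in>S. \<forall>v\<in>T. \<xi> u v \<in> normal_plane u v)"

text \<open>
  The normal connection is \<open>D\<^sub>X \<xi>\<close> = normal part of the flat derivative of \<open>\<xi>\<close> along \<open>X\<close>; it is
  linear in \<open>X\<close>, so vanishing on the two coordinate fields is vanishing identically.
\<close>

definition parallel_normal_field :: "(real \<Rightarrow> real \<Rightarrow> real^4) \<Rightarrow> bool" where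
  "parallel_normal_field \<xi> \<longleftrightarrow> normal_field \<xi> \<and>
     (\<forall>u\<in>S. \<forall>v\<in>T. normal_part u v (pd1 S \<xi> u v) = 0 \<and> normal_part u v (pd2 T \<xi> u v) = 0)"

definition parallel_normalized_mean_curvature :: bool where
  "parallel_normalized_mean_curvature \<longleftrightarrow>
     (\<forall>u\<in>S. \<forall>v\<in>T. mean_curvature_vector u v \<noteq> 0) \<and>
     (\<exists>\<xi>. (\<exists>\<epsilon>\<in>{1, -1}. \<forall>u\<in>S. \<forall>v\<in>T. pdot (\<xi> u v) (\<xi> u v) = \<epsilon>) \<and>
          (\<forall>u\<in>S. \<forall>v\<in>T. \<exists>c. mean_curvature_vector u v = c *\<^sub>R \<xi> u v) \<and>
          parallel_normal_field \<xi>)"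

end

subsection \<open>Rotational surfaces of hyperbolic type and their meridians\<close>

definition hyperbolic_rotational_surface ::
    "real \<Rightarrow> real \<Rightarrow> (real \<Rightarrow> real) \<Rightarrow> (real \<Rightarrow> real) \<Rightarrow> real \<Rightarrow> real \<Rightarrow> real^4" where
  "hyperbolic_rotational_surface \<alpha> \<beta> f g u v =
     vector [f u * cosh (\<alpha> * v), g u * cosh (\<beta> * v), f u * sinh (\<alpha> * v), g u * sinh (\<beta> * v)]"

text \<open>
  On \<open>K\<close> the plane curve \<open>(f, g)\<close> arises from the curve \<open>(x, y)\<close>, defined on \<open>A\<close>, by a regular
  change of parameter.
\<close>

definition reparametrizes ::
    "real set \<Rightarrow> (real \<Rightarrow> real) \<Rightarrow> (real \<Rightarrow> real) \<Rightarrow> real set \<Rightarrow> (real \<Rightarrow> real) \<Rightarrow> (real \<Rightarrow> real) \<Rightarrow> bool" where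
  "reparametrizes K f g A x y \<longleftrightarrow>
     (\<exists>\<phi>. smooth1 K \<phi> \<and> (\<forall>u\<in>K. vector_derivative \<phi> (at u within K) \<noteq> 0) \<and> \<phi> ` K \<subseteq> A \<and>
          (\<forall>u\<in>K. f u = x (\<phi> u) \<and> g u = y (\<phi> u)))"

text \<open>
  The meridian is determined by \<open>f(s) = \<plusminus>\<surd>(C\<^sup>2 - s\<^sup>2)\<close>, \<open>g(s) = s\<close> up to a change of parameter:
  every point traced by \<open>(f, g)\<close> lies on one of the two branches, and wherever \<open>f\<close> has no zero
  the curve is a regular reparametrisation of a single branch. The first clause alone is used at
  the zeros of \<open>f\<close>, i.e. at \<open>s = \<plusminus>\<bar>C\<bar>\<close>, where the branches meet and the root is not differentiable;
  a smooth meridian may pass from one branch to the other there.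
\<close>

definition meridian_determined_by :: "real set \<Rightarrow> (real \<Rightarrow> real) \<Rightarrow> (real \<Rightarrow> real) \<Rightarrow> real \<Rightarrow> bool" where
  "meridian_determined_by J f g C \<longleftrightarrow>
     (\<lambda>u. (f u, g u)) ` J \<subseteq>
       (\<Union>\<epsilon>\<in>{1, -1}. (\<lambda>s. (\<epsilon> * sqrt (C\<^sup>2 - s\<^sup>2), s)) ` {-\<bar>C\<bar>..\<bar>C\<bar>}) \<and>
     (\<forall>K. is_interval K \<and> interior K \<noteq> {} \<and> K \<subseteq> J \<and> (\<forall>u\<in>K. f u \<noteq> 0) \<longrightarrow>
        (\<exists>\<epsilon>\<in>{1, -1}. reparametrizes K f g {-\<bar>C\<bar><..<\<bar>C\<bar>} (\<lambda>s. \<epsilon> * sqrt (C\<^sup>2 - s\<^sup>2)) (\<lambda>s. s)))"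

end

theory Submission imports Defs begin

text \<open>
  The surface is swept out by the one-parameter group of boosts \<open>B\<^sub>v\<close> acting in the planes of the
  coordinates 1, 3 and 2, 4. This group is isometric, so every vector field in sight has the form
  \<open>B\<^sub>v (x, y, 0, 0)\<close> or \<open>B\<^sub>v (0, 0, x, y)\<close> with \<open>x, y\<close> depending on \<open>u\<close> only, and the geometry reduces
  to plane algebra. The coordinate fields are \<open>z\<^sub>u = B\<^sub>v (f', g', 0, 0)\<close> and
  \<open>z\<^sub>v = B\<^sub>v (0, 0, \<alpha> f, \<beta> g)\<close>; the normal plane is spanned by \<open>n = B\<^sub>v (g', -f', 0, 0)\<close> and
  \<open>b = B\<^sub>v (0, 0, \<beta> g, -\<alpha> f)\<close>.

  Since the coordinate fields are orthogonal and both \<open>z\<^sub>u\<^sub>u\<close> and \<open>z\<^sub>v\<^sub>v\<close> are of the first form, the mean curvature vector is orthogonal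
  to \<open>b\<close>, hence a multiple of \<open>n\<close>. Suppose \<open>\<xi>\<close> is a parallel unit field along it. Differentiating
  \<open>\<langle>b, \<xi>\<rangle> = 0\<close> in the direction of \<open>v\<close> and using that \<open>D\<^sub>v \<xi> = 0\<close> gives \<open>\<langle>b\<^sub>v, \<xi>\<rangle> = 0\<close>, where
  \<open>b\<^sub>v = \<alpha> \<beta> B\<^sub>v (g, -f, 0, 0)\<close>. As \<open>\<xi>\<close> is a nonzero multiple of \<open>n\<close>, this says \<open>f f' + g g' = 0\<close>: the
  meridian lies on a circle about the origin
  (\<open>rotational_meridian.parallel_imp_radius_stationary\<close>). The coordinate \<open>g\<close> is then a regular
  parameter wherever \<open>f \<noteq> 0\<close> (\<open>circle_imp_meridian_determined\<close>).

  Conversely, if \<open>f\<^sup>2 + g\<^sup>2 = C\<^sup>2\<close>, the surface lies in the pseudosphere \<open>\<langle>x, x\<rangle> = C\<^sup>2\<close> and is minimal there, so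
  \<open>H = - z / C\<^sup>2\<close>. The unit field \<open>z / C\<close> is normal and its derivatives are tangent to the surface; hence
  it is parallel (\<open>rotational_meridian.circle_imp_parallel\<close>).
\<close>

section \<open>Vector calculus in coordinates\<close>

lemma has_vector_derivative_vec_nthI:
  fixes f :: "real \<Rightarrow> real^'n"
  assumes "\<And>i. ((\<lambda>t. f t $ i) has_real_derivative d $ i) (at a within S)"
  shows "(f has_vector_derivative d) (at a within S)"
  unfolding has_vector_derivative_def
proof (rule iffD2[OF has_derivative_componentwise_within], rule ballI)
  fix b :: "real^'n" assume "b \<in> Basis"
  then obtain i where b: "b = axis i 1" by (auto simp: Basis_vec_def)
  have "(\<lambda>h. h * d $ i) = (*) (d $ i)" by (simp add: fun_eq_iff mult.commute)
  then show "((\<lambda>t. f t \<bullet> b) has_derivative (\<lambda>h. (h *\<^sub>R d) \<bullet> b)) (at a within S)"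
    using assms[of i] by (simp add: b inner_axis has_field_derivative_def)
qed

lemma continuous_on_vec_nthI:
  fixes f :: "'b::topological_space \<Rightarrow> real^'n"
  assumes "\<And>i. continuous_on S (\<lambda>x. f x $ i)"
  shows "continuous_on S f"
  using continuous_on_vec_lambda[of S "\<lambda>i x. f x $ i"] assms by simp

lemma at_within_connected_neq_bot:
  fixes S :: "real set"
  assumes "connected S" "interior S \<noteq> {}" "x \<in> S"
  shows "at x within S \<noteq> bot"
proof -
  have "S \<noteq> {x}" using assms(2) interior_singleton[of x] by auto
  then have "x islimpt S"
    using connected_imp_perfect[of S x] assms by auto
  then show ?thesis by (simp add: trivial_limit_within)
qed

lemma vector_derivative_cong_within:
  assumes "\<And>x. x \<in> S \<Longrightarrow> f x = g x" "a \<in> S"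
  shows "vector_derivative f (at a within S) = vector_derivative g (at a within S)"
proof -
  have "(f has_vector_derivative d) (at a within S) \<longleftrightarrow> (g has_vector_derivative d) (at a within S)" for d
    using has_vector_derivative_transform[OF assms(2), of f g d]
      has_vector_derivative_transform[OF assms(2), of g f d] assms(1) by auto
  then show ?thesis by (simp add: vector_derivative_def)
qed

lemma constant_on_imp_derivative_0:
  assumes "at a within S \<noteq> bot" "a \<in> S" "\<And>x. x \<in> S \<Longrightarrow> f x = c"
    and "(f has_real_derivative d) (at a within S)"
  shows "d = 0"
proof -
  have "(f has_vector_derivative 0) (at a within S)"
    by (rule has_vector_derivative_transform[OF assms(2) _ has_vector_derivative_const[of c]])
      (use assms(3) in auto)
  then show ?thesis
    using vector_derivative_unique_within[OF assms(1)] assms(4)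
    unfolding has_real_derivative_iff_has_vector_derivative by blast
qed

lemma pdot_commute: "pdot x y = pdot y x"
  by (simp add: pdot_def mult.commute)

lemma pdot_add_right: "pdot x (y + z) = pdot x y + pdot x z"
  and pdot_diff_right: "pdot x (y - z) = pdot x y - pdot x z"
  and pdot_diff_left: "pdot (y - z) x = pdot y x - pdot z x"
  and pdot_scaleR_right: "pdot x (c *\<^sub>R y) = c * pdot x y"
  and pdot_scaleR_left: "pdot (c *\<^sub>R y) x = c * pdot y x"
  by (simp_all add: pdot_def algebra_simps)

lemma has_real_derivative_pdot:
  assumes "(x has_vector_derivative x') (at t within S)" "(y has_vector_derivative y') (at t within S)"
  shows "((\<lambda>s. pdot (x s) (y s)) has_real_derivative pdot x' (y t) + pdot (x t) y') (at t within S)"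
proof -
  have nth: "((\<lambda>s. f s $ i) has_real_derivative f' $ i) (at t within S)"
    if "(f has_vector_derivative f') (at t within S)" for f :: "real \<Rightarrow> real^4" and f' i
    using bounded_linear.has_vector_derivative[OF bounded_linear_vec_nth that, of i]
    by (simp add: has_real_derivative_iff_has_vector_derivative)
  show ?thesis
    unfolding pdot_def
    by (rule derivative_eq_intros nth assms refl)+ (simp add: algebra_simps)
qed

section \<open>The normal component on a nondegenerate surface\<close>

lemma tangent_plane_iff:
  "w \<in> tangent_plane S T z u v \<longleftrightarrow> (\<exists>a b. w = a *\<^sub>R pd1 S z u v + b *\<^sub>R pd2 T z u v)"
  by (auto simp: tangent_plane_def span_insert span_singleton algebra_simps)

lemma normal_plane_iff:
  "n \<in> normal_plane S T z u v \<longleftrightarrow> pdot n (pd1 S z u v) = 0 \<and> pdot n (pd2 T z u v) = 0"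
proof
  assume n: "n \<in> normal_plane S T z u v"
  have "pd1 S z u v \<in> tangent_plane S T z u v" "pd2 T z u v \<in> tangent_plane S T z u v"
    by (auto simp: tangent_plane_def intro: span_base)
  then show "pdot n (pd1 S z u v) = 0 \<and> pdot n (pd2 T z u v) = 0"
    using n by (simp add: normal_plane_def)
qed (auto simp: normal_plane_def tangent_plane_iff pdot_add_right pdot_scaleR_right)

context
  fixes S T :: "real set" and z :: "real \<Rightarrow> real \<Rightarrow> real^4" and u v :: real
  assumes nondegenerate: "fff_E S z u v * fff_G T z u v - (fff_F S T z u v)\<^sup>2 \<noteq> 0"
begin

lemma tangent_normal_eq_0:
  assumes "w \<in> tangent_plane S T z u v" "w \<in> normal_plane S T z u v"
  shows "w = 0"
proof -
  obtain a b where w: "w = a *\<^sub>R pd1 S z u v + b *\<^sub>R pd2 T z u v"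
    using assms(1) by (auto simp: tangent_plane_iff)
  let ?E = "fff_E S z u v" and ?F = "fff_F S T z u v" and ?G = "fff_G T z u v"
  have 1: "a * ?E + b * ?F = 0" "a * ?F + b * ?G = 0"
    using assms(2) unfolding normal_plane_iff w fff_E_def fff_F_def fff_G_def
    by (simp_all add: pdot_commute[of "_ + _"] pdot_add_right pdot_scaleR_right pdot_commute[of "pd2 T z u v" "pd1 S z u v"])
  have "a * (?E * ?G - ?F\<^sup>2) = 0" "b * (?E * ?G - ?F\<^sup>2) = 0"
    using 1 by algebra+
  then show ?thesis using nondegenerate w by simp
qed

lemma normal_part_eqI:
  assumes "n \<in> normal_plane S T z u v" "w - n \<in> tangent_plane S T z u v"
  shows "normal_part S T z u v w = n"
  unfolding normal_part_def
proof (rule the_equality)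
  fix m assume m: "m \<in> normal_plane S T z u v \<and> w - m \<in> tangent_plane S T z u v"
  have "(w - n) - (w - m) \<in> tangent_plane S T z u v"
    using assms(2) m unfolding tangent_plane_def by (blast intro: span_diff)
  moreover have "m - n \<in> normal_plane S T z u v"
    using assms(1) m by (simp add: normal_plane_iff pdot_diff_left)
  ultimately show "m = n"
    using tangent_normal_eq_0[of "m - n"] by simp
qed (use assms in simp)

lemma normal_part_tangent: "w \<in> tangent_plane S T z u v \<Longrightarrow> normal_part S T z u v w = 0"
  by (rule normal_part_eqI) (auto simp: normal_plane_iff pdot_def)

text \<open>
  The normal component is given by a definite description, so nothing can be said about it before
  existence is known. Existence amounts to solving the Gram system of the tangential component,
  whose determinant is \<open>E G - F\<^sup>2\<close>.
\<close>
lemma normal_part_decomposition: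
  "normal_part S T z u v w \<in> normal_plane S T z u v" (is ?N)
  "w - normal_part S T z u v w \<in> tangent_plane S T z u v" (is ?T)
proof -
  let ?E = "fff_E S z u v" and ?F = "fff_F S T z u v" and ?G = "fff_G T z u v"
  let ?D = "?E * ?G - ?F\<^sup>2"
  let ?p = "pdot w (pd1 S z u v)" and ?q = "pdot w (pd2 T z u v)"
  \<comment> \<open>The coefficients of \<open>?t\<close> come from Cramer's rule.\<close>
  let ?t = "((?p * ?G - ?q * ?F) / ?D) *\<^sub>R pd1 S z u v + ((?q * ?E - ?p * ?F) / ?D) *\<^sub>R pd2 T z u v"
  have "((?p * ?G - ?q * ?F) / ?D) * ?E + ((?q * ?E - ?p * ?F) / ?D) * ?F = ?p * ?D / ?D"
    by (simp add: add_divide_distrib[symmetric] algebra_simps power2_eq_square)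
  moreover have "((?p * ?G - ?q * ?F) / ?D) * ?F + ((?q * ?E - ?p * ?F) / ?D) * ?G = ?q * ?D / ?D"
    by (simp add: add_divide_distrib[symmetric] algebra_simps power2_eq_square)
  ultimately have "w - ?t \<in> normal_plane S T z u v"
    using nondegenerate unfolding normal_plane_iff
    by (simp add: pdot_diff_left pdot_commute[of "_ + _"] pdot_add_right pdot_scaleR_right
        pdot_commute[of "pd2 T z u v" "pd1 S z u v"] flip: fff_E_def fff_F_def fff_G_def)
  moreover have "w - (w - ?t) \<in> tangent_plane S T z u v"
    by (auto simp: tangent_plane_iff)
  ultimately show ?N ?T
    using normal_part_eqI by metis+
qed

text \<open>Components of the second fundamental form along a normal direction need no projection.\<close>
lemma pdot_normal_part:
  assumes "m \<in> normal_plane S T z u v"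
  shows "pdot m (normal_part S T z u v w) = pdot m w"
  using assms normal_part_decomposition(2)[of w]
  by (auto simp: normal_plane_def pdot_diff_right)

end

section \<open>Boosts\<close>

text \<open>
  The boost with parameter \<open>v\<close> applied to \<open>(x, y, 0, 0)\<close> in the positive definite coordinate plane,
  and below to \<open>(0, 0, x, y)\<close> in the negative definite one.
\<close>
definition boost_pos :: "real \<Rightarrow> real \<Rightarrow> real \<Rightarrow> real \<Rightarrow> real \<Rightarrow> real^4" where
  "boost_pos \<alpha> \<beta> v x y = vector [x * cosh (\<alpha> * v), y * cosh (\<beta> * v), x * sinh (\<alpha> * v), y * sinh (\<beta> * v)]"

definition boost_neg :: "real \<Rightarrow> real \<Rightarrow> real \<Rightarrow> real \<Rightarrow> real \<Rightarrow> real^4" where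
  "boost_neg \<alpha> \<beta> v x y = vector [x * sinh (\<alpha> * v), y * sinh (\<beta> * v), x * cosh (\<alpha> * v), y * cosh (\<beta> * v)]"

lemma vector4_nth [simp]:
  "(vector [a, b, c, d] :: real^4) $ 1 = a" "(vector [a, b, c, d] :: real^4) $ 2 = b"
  "(vector [a, b, c, d] :: real^4) $ 3 = c" "(vector [a, b, c, d] :: real^4) $ 4 = d"
  by (simp_all add: vector_def)

lemma hyperbolic_rotational_surface_eq_boost:
  "hyperbolic_rotational_surface \<alpha> \<beta> f g = (\<lambda>u v. boost_pos \<alpha> \<beta> v (f u) (g u))"
  by (simp add: fun_eq_iff hyperbolic_rotational_surface_def boost_pos_def)

text \<open>Boosts are isometries and the two coordinate planes are orthogonal, so the scalar products are those at \<open>v = 0\<close>.\<close>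
lemma pdot_boost:
  "pdot (boost_pos \<alpha> \<beta> v x y) (boost_pos \<alpha> \<beta> v x' y') = x * x' + y * y'"
  "pdot (boost_neg \<alpha> \<beta> v x y) (boost_neg \<alpha> \<beta> v x' y') = - (x * x' + y * y')"
  "pdot (boost_pos \<alpha> \<beta> v x y) (boost_neg \<alpha> \<beta> v x' y') = 0"
  "pdot (boost_neg \<alpha> \<beta> v x y) (boost_pos \<alpha> \<beta> v x' y') = 0"
proof -
  have c: "cosh t * cosh t = 1 + sinh t * sinh t" for t :: real
    using cosh_square_eq[of t] by (simp add: power2_eq_square)
  have p: "x * cosh a * (x' * cosh a) = x * x' * (cosh a * cosh a)" for a x x' :: real
    by simp
  show "pdot (boost_pos \<alpha> \<beta> v x y) (boost_pos \<alpha> \<beta> v x' y') = x * x' + y * y'"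
    "pdot (boost_neg \<alpha> \<beta> v x y) (boost_neg \<alpha> \<beta> v x' y') = - (x * x' + y * y')"
    "pdot (boost_pos \<alpha> \<beta> v x y) (boost_neg \<alpha> \<beta> v x' y') = 0"
    "pdot (boost_neg \<alpha> \<beta> v x y) (boost_pos \<alpha> \<beta> v x' y') = 0"
    unfolding pdot_def boost_pos_def boost_neg_def vector4_nth p c
    by (simp_all add: algebra_simps)
qed

lemma boost_pos_diff: "boost_pos \<alpha> \<beta> v x y - boost_pos \<alpha> \<beta> v x' y' = boost_pos \<alpha> \<beta> v (x - x') (y - y')"
  and boost_pos_scaleR: "c *\<^sub>R boost_pos \<alpha> \<beta> v x y = boost_pos \<alpha> \<beta> v (c * x) (c * y)"
  and boost_neg_scaleR: "c *\<^sub>R boost_neg \<alpha> \<beta> v x y = boost_neg \<alpha> \<beta> v (c * x) (c * y)"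
  by (simp_all add: boost_pos_def boost_neg_def vec_eq_iff forall_4 algebra_simps)

text \<open>
  The generator of the boosts exchanges the two definite planes, so derivatives of even and odd order in
  \<open>v\<close> come from different planes.
\<close>
lemma has_vector_derivative_boost_angle:
  "((\<lambda>t. boost_pos \<alpha> \<beta> t x y) has_vector_derivative boost_neg \<alpha> \<beta> v (\<alpha> * x) (\<beta> * y)) (at v within T)"
  "((\<lambda>t. boost_neg \<alpha> \<beta> t x y) has_vector_derivative boost_pos \<alpha> \<beta> v (\<alpha> * x) (\<beta> * y)) (at v within T)"
proof -
  have "\<forall>i. ((\<lambda>t. boost_pos \<alpha> \<beta> t x y $ i) has_real_derivative boost_neg \<alpha> \<beta> v (\<alpha> * x) (\<beta> * y) $ i) (at v within T)"
    "\<forall>i. ((\<lambda>t. boost_neg \<alpha> \<beta> t x y $ i) has_real_derivative boost_pos \<alpha> \<beta> v (\<alpha> * x) (\<beta> * y) $ i) (at v within T)"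
    unfolding forall_4 boost_pos_def boost_neg_def vector4_nth
    by (intro conjI; (rule derivative_eq_intros refl)+; simp)+
  then show "((\<lambda>t. boost_pos \<alpha> \<beta> t x y) has_vector_derivative boost_neg \<alpha> \<beta> v (\<alpha> * x) (\<beta> * y)) (at v within T)"
  "((\<lambda>t. boost_neg \<alpha> \<beta> t x y) has_vector_derivative boost_pos \<alpha> \<beta> v (\<alpha> * x) (\<beta> * y)) (at v within T)"
    by (simp_all add: has_vector_derivative_vec_nthI)
qed

lemma has_vector_derivative_boost_point:
  assumes "(f has_real_derivative f') (at u within S)" "(g has_real_derivative g') (at u within S)"
  shows "((\<lambda>s. boost_pos \<alpha> \<beta> v (f s) (g s)) has_vector_derivative boost_pos \<alpha> \<beta> v f' g') (at u within S)"
    and "((\<lambda>s. boost_neg \<alpha> \<beta> v (f s) (g s)) has_vector_derivative boost_neg \<alpha> \<beta> v f' g') (at u within S)"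
proof -
  have "\<forall>i. ((\<lambda>s. boost_pos \<alpha> \<beta> v (f s) (g s) $ i) has_real_derivative boost_pos \<alpha> \<beta> v f' g' $ i) (at u within S)"
    "\<forall>i. ((\<lambda>s. boost_neg \<alpha> \<beta> v (f s) (g s) $ i) has_real_derivative boost_neg \<alpha> \<beta> v f' g' $ i) (at u within S)"
    unfolding forall_4 boost_pos_def boost_neg_def vector4_nth
    by (intro conjI DERIV_cmult_right assms)+
  then show "((\<lambda>s. boost_pos \<alpha> \<beta> v (f s) (g s)) has_vector_derivative boost_pos \<alpha> \<beta> v f' g') (at u within S)"
    "((\<lambda>s. boost_neg \<alpha> \<beta> v (f s) (g s)) has_vector_derivative boost_neg \<alpha> \<beta> v f' g') (at u within S)"
    by (simp_all add: has_vector_derivative_vec_nthI)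
qed

lemma continuous_on_boost:
  assumes "continuous_on S f" "continuous_on S g" 
  shows "continuous_on (S \<times> T) (\<lambda>(u, v). boost_pos \<alpha> \<beta> v (f u) (g u))"
    and "continuous_on (S \<times> T) (\<lambda>(u, v). boost_neg \<alpha> \<beta> v (f u) (g u))"
proof -
  have [continuous_intros]: "continuous_on (S \<times> T) (\<lambda>p. f (fst p))" "continuous_on (S \<times> T) (\<lambda>p. g (fst p))"
    by (auto intro!: continuous_on_compose2[OF assms(1)] continuous_on_compose2[OF assms(2)] continuous_intros)
  have "\<forall>i. continuous_on (S \<times> T) (\<lambda>p. boost_pos \<alpha> \<beta> (snd p) (f (fst p)) (g (fst p)) $ i)"
    "\<forall>i. continuous_on (S \<times> T) (\<lambda>p. boost_neg \<alpha> \<beta> (snd p) (f (fst p)) (g (fst p)) $ i)"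
    unfolding forall_4 boost_pos_def boost_neg_def vector4_nth
    by (auto intro!: continuous_intros)
  then show "continuous_on (S \<times> T) (\<lambda>(u, v). boost_pos \<alpha> \<beta> v (f u) (g u))"
    "continuous_on (S \<times> T) (\<lambda>(u, v). boost_neg \<alpha> \<beta> v (f u) (g u))"
    unfolding case_prod_unfold by (simp_all add: continuous_on_vec_nthI)
qed

lemma smooth2_boost:
  fixes F G :: "nat \<Rightarrow> real \<Rightarrow> real"
  assumes F: "\<And>n u. u \<in> S \<Longrightarrow> (F n has_real_derivative F (Suc n) u) (at u within S)"
    and G: "\<And>n u. u \<in> S \<Longrightarrow> (G n has_real_derivative G (Suc n) u) (at u within S)"
  shows "smooth2 S T (\<lambda>u v. boost_pos \<alpha> \<beta> v (F 0 u) (G 0 u))"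
proof -
  define D where "D i j u v =
    (if even j then boost_pos else boost_neg) \<alpha> \<beta> v (\<alpha>^j * F i u) (\<beta>^j * G i u)" for i j u v
  have "continuous_on S (F n)" "continuous_on S (G n)" for n
    using DERIV_continuous_on[OF F] DERIV_continuous_on[OF G] by blast+
  then have "continuous_on S (\<lambda>u. \<alpha>^j * F i u)" "continuous_on S (\<lambda>u. \<beta>^j * G i u)" for i j
    by (simp_all add: continuous_on_mult_left)
  from continuous_on_boost[OF this] have "continuous_on (S \<times> T) (\<lambda>(u, v). D i j u v)" for i j
    unfolding D_def by (cases "even j") simp_all
  moreover have "((\<lambda>s. D i j s v) has_vector_derivative D (Suc i) j u v) (at u within S)" if "u \<in> S" for i j u v
    using has_vector_derivative_boost_point[OF DERIV_cmult[OF F] DERIV_cmult[OF G], OF that that]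
    unfolding D_def by (cases "even j") simp_all
  moreover have "((\<lambda>t. D i j u t) has_vector_derivative D i (Suc j) u v) (at v within T)" for i j u v
    using has_vector_derivative_boost_angle[of \<alpha> \<beta> "\<alpha>^j * F i u" "\<beta>^j * G i u" v T]
    unfolding D_def by (simp add: mult.assoc)
  moreover have "D 0 0 = (\<lambda>u v. boost_pos \<alpha> \<beta> v (F 0 u) (G 0 u))"
    by (simp add: D_def fun_eq_iff)
  ultimately show ?thesis
    unfolding smooth2_def by (intro exI[of _ D] conjI allI ballI)
qed

section \<open>The rotational surface\<close>

text \<open>
  The meridian enters with all its derivatives, as \<open>F n\<close> and \<open>G n\<close>. The parameter sets have no
  isolated points, which makes derivatives within them unique.
\<close>
locale rotational_meridian =
  fixes J T :: "real set" and \<alpha> \<beta> :: real and F G :: "nat \<Rightarrow> real \<Rightarrow> real"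
  assumes J_limit: "u \<in> J \<Longrightarrow> at u within J \<noteq> bot"
    and T_limit: "v \<in> T \<Longrightarrow> at v within T \<noteq> bot"
    and F_deriv: "u \<in> J \<Longrightarrow> (F n has_real_derivative F (Suc n) u) (at u within J)"
    and G_deriv: "u \<in> J \<Longrightarrow> (G n has_real_derivative G (Suc n) u) (at u within J)"
    and regular: "u \<in> J \<Longrightarrow> (F 1 u)\<^sup>2 + (G 1 u)\<^sup>2 > 0"
    and lorentz: "u \<in> J \<Longrightarrow> \<alpha>\<^sup>2 * (F 0 u)\<^sup>2 + \<beta>\<^sup>2 * (G 0 u)\<^sup>2 > 0"
begin

abbreviation z :: "real \<Rightarrow> real \<Rightarrow> real^4" where
  "z \<equiv> \<lambda>u v. boost_pos \<alpha> \<beta> v (F 0 u) (G 0 u)"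

lemma pd1_boost:
  assumes "u \<in> J" "(f has_real_derivative f') (at u within J)" "(g has_real_derivative g') (at u within J)"
  shows "pd1 J (\<lambda>u v. boost_pos \<alpha> \<beta> v (f u) (g u)) u v = boost_pos \<alpha> \<beta> v f' g'"
  unfolding pd1_def using assms J_limit
  by (intro vector_derivative_within has_vector_derivative_boost_point) auto

lemma pd2_boost:
  assumes "v \<in> T"
  shows "pd2 T (\<lambda>u v. boost_pos \<alpha> \<beta> v (f u) (g u)) u v = boost_neg \<alpha> \<beta> v (\<alpha> * f u) (\<beta> * g u)"
  unfolding pd2_def using assms T_limit
  by (intro vector_derivative_within has_vector_derivative_boost_angle) auto

lemma z_1: "u \<in> J \<Longrightarrow> pd1 J z u v = boost_pos \<alpha> \<beta> v (F 1 u) (G 1 u)"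
  using pd1_boost F_deriv[of u 0] G_deriv[of u 0] by simp

lemma z_2: "v \<in> T \<Longrightarrow> pd2 T z u v = boost_neg \<alpha> \<beta> v (\<alpha> * F 0 u) (\<beta> * G 0 u)"
  by (rule pd2_boost)

lemma z_11:
  assumes "u \<in> J"
  shows "pd1 J (pd1 J z) u v = boost_pos \<alpha> \<beta> v (F 2 u) (G 2 u)"
proof -
  have "pd1 J (pd1 J z) u v = pd1 J (\<lambda>u v. boost_pos \<alpha> \<beta> v (F 1 u) (G 1 u)) u v"
    unfolding pd1_def[of J "pd1 J z"] pd1_def[of J "\<lambda>u v. boost_pos \<alpha> \<beta> v (F 1 u) (G 1 u)"]
    by (rule vector_derivative_cong_within) (simp_all add: z_1 assms)
  also have "\<dots> = boost_pos \<alpha> \<beta> v (F 2 u) (G 2 u)"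
    using pd1_boost assms F_deriv[of u 1] G_deriv[of u 1] by (simp add: numeral_2_eq_2)
  finally show ?thesis .
qed

lemma z_22:
  assumes "v \<in> T"
  shows "pd2 T (pd2 T z) u v = boost_pos \<alpha> \<beta> v (\<alpha>\<^sup>2 * F 0 u) (\<beta>\<^sup>2 * G 0 u)"
proof -
  have "pd2 T (pd2 T z) u v
    = vector_derivative (\<lambda>t. boost_neg \<alpha> \<beta> t (\<alpha> * F 0 u) (\<beta> * G 0 u)) (at v within T)"
    unfolding pd2_def[of T "pd2 T z"]
    by (rule vector_derivative_cong_within) (simp_all add: z_2 assms)
  also have "\<dots> = boost_pos \<alpha> \<beta> v (\<alpha> * (\<alpha> * F 0 u)) (\<beta> * (\<beta> * G 0 u))"
    using assms T_limit by (intro vector_derivative_within has_vector_derivative_boost_angle) auto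
  finally show ?thesis by (simp add: power2_eq_square mult.assoc)
qed

lemma first_fundamental_form:
  assumes "u \<in> J" "v \<in> T"
  shows "fff_E J z u v = (F 1 u)\<^sup>2 + (G 1 u)\<^sup>2" "fff_F J T z u v = 0"
    "fff_G T z u v = - (\<alpha>\<^sup>2 * (F 0 u)\<^sup>2 + \<beta>\<^sup>2 * (G 0 u)\<^sup>2)"
  using assms
  by (simp_all add: fff_E_def fff_F_def fff_G_def z_1 z_2 pdot_boost power2_eq_square algebra_simps)

lemma nondegenerate:
  assumes "u \<in> J" "v \<in> T"
  shows "fff_E J z u v * fff_G T z u v - (fff_F J T z u v)\<^sup>2 \<noteq> 0"
proof -
  have "fff_E J z u v * fff_G T z u v < 0"
    unfolding first_fundamental_form[OF assms]
    using regular[OF assms(1)] lorentz[OF assms(1)] by (simp only: mult_pos_neg neg_less_0_iff_less)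
  then show ?thesis using first_fundamental_form(2)[OF assms] by auto
qed

text \<open>
  The second normal direction, the one not met by the mean curvature vector.
\<close>
definition binormal :: "real \<Rightarrow> real \<Rightarrow> real^4" where
  "binormal u v = boost_neg \<alpha> \<beta> v (\<beta> * G 0 u) (- (\<alpha> * F 0 u))"

lemma binormal_in_normal_plane:
  "u \<in> J \<Longrightarrow> v \<in> T \<Longrightarrow> binormal u v \<in> normal_plane J T z u v"
  by (simp add: normal_plane_iff binormal_def z_1 z_2 pdot_boost)

text \<open>
  Because the coordinate fields are orthogonal, the mixed term of the second fundamental form, which is the one with a component along
  the binormal, drops out of the trace.
\<close>
lemma mean_curvature_orthogonal_binormal:
  assumes "u \<in> J" "v \<in> T"
  shows "pdot (binormal u v) (mean_curvature_vector J T z u v) = 0"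
proof -
  note pdot_binormal = pdot_normal_part[OF nondegenerate[OF assms] binormal_in_normal_plane[OF assms]]
  have "pdot (binormal u v) (sff_11 J T z u v) = 0" "pdot (binormal u v) (sff_22 J T z u v) = 0"
    unfolding sff_11_def sff_22_def pdot_binormal
    using assms by (simp_all add: z_11 z_22 binormal_def pdot_boost)
  then show ?thesis
    by (simp add: mean_curvature_vector_def first_fundamental_form[OF assms]
        pdot_scaleR_right pdot_add_right pdot_diff_right)
qed

text \<open>
  The binormal, being orthogonal to the parallel field \<open>\<xi>\<close>, must have its \<open>v\<close>-derivative orthogonal to \<open>\<xi>\<close>
  too. That derivative is a multiple of the boost of \<open>(g, -f)\<close>, while \<open>\<xi>\<close> is a multiple of the boost of
  \<open>(g', -f')\<close>. One value of \<open>v\<close> suffices for this, and at \<open>v = 0\<close> the boost is the identity.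
\<close>
lemma parallel_imp_radius_stationary:
  assumes par: "parallel_normalized_mean_curvature J T z"
    and "0 \<in> T" "u \<in> J" "\<alpha> \<noteq> 0" "\<beta> \<noteq> 0"
  shows "F 0 u * F 1 u + G 0 u * G 1 u = 0"
proof -
  note par = par[unfolded parallel_normalized_mean_curvature_def]
  have H: "mean_curvature_vector J T z u v \<noteq> 0" if "v \<in> T" for v
    using conjunct1[OF par] \<open>u \<in> J\<close> that by simp
  obtain \<xi> where unit: "\<exists>\<epsilon>\<in>{1, -1}. \<forall>u\<in>J. \<forall>v\<in>T. pdot (\<xi> u v) (\<xi> u v) = \<epsilon>"
    and dir: "\<forall>u\<in>J. \<forall>v\<in>T. \<exists>c. mean_curvature_vector J T z u v = c *\<^sub>R \<xi> u v"
    and \<xi>: "parallel_normal_field J T z \<xi>"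
    using conjunct2[OF par] by (elim exE conjE) (rule that)
  have unit0: "pdot (\<xi> u 0) (\<xi> u 0) \<noteq> 0"
    using unit \<open>u \<in> J\<close> \<open>0 \<in> T\<close> by auto
  \<comment> \<open>The factor between \<open>H\<close> and \<open>\<xi>\<close> is nonzero because \<open>H\<close> is, so \<open>\<xi>\<close> inherits the orthogonality.\<close>
  have orth: "pdot (binormal u v) (\<xi> u v) = 0" if "v \<in> T" for v
  proof -
    obtain c where c: "mean_curvature_vector J T z u v = c *\<^sub>R \<xi> u v"
      using dir \<open>u \<in> J\<close> \<open>v \<in> T\<close> by blast
    then have "c \<noteq> 0" using H[OF \<open>v \<in> T\<close>] by auto
    then show ?thesis
      using mean_curvature_orthogonal_binormal[OF \<open>u \<in> J\<close> \<open>v \<in> T\<close>] c by (simp add: pdot_scaleR_right)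
  qed
  have "smooth2 J T \<xi>"
    using \<xi> by (simp add: parallel_normal_field_def normal_field_def)
  then obtain D where D0: "D 0 0 = \<xi>"
    and D: "\<forall>i j. continuous_on (J \<times> T) (\<lambda>(u, v). D i j u v) \<and>
          (\<forall>u\<in>J. \<forall>v\<in>T.
             ((\<lambda>s. D i j s v) has_vector_derivative D (Suc i) j u v) (at u within J) \<and>
             ((\<lambda>t. D i j u t) has_vector_derivative D i (Suc j) u v) (at v within T))"
    unfolding smooth2_def by (elim exE conjE) (rule that)
  have d\<xi>: "((\<lambda>t. \<xi> u t) has_vector_derivative D 0 1 u 0) (at 0 within T)"
    using D[rule_format, of 0 0] \<open>u \<in> J\<close> \<open>0 \<in> T\<close> by (simp add: D0)
  then have pd2\<xi>: "pd2 T \<xi> u 0 = D 0 1 u 0"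
    unfolding pd2_def using T_limit \<open>0 \<in> T\<close> by (intro vector_derivative_within) auto
  have d\<xi>_orth: "pdot (binormal u 0) (D 0 1 u 0) = 0"
  proof -
    have "normal_part J T z u 0 (D 0 1 u 0) = 0"
      unfolding pd2\<xi>[symmetric]
      using \<xi> \<open>u \<in> J\<close> \<open>0 \<in> T\<close> by (simp add: parallel_normal_field_def)
    then show ?thesis
      using pdot_normal_part[OF nondegenerate binormal_in_normal_plane, OF \<open>u \<in> J\<close> \<open>0 \<in> T\<close> \<open>u \<in> J\<close> \<open>0 \<in> T\<close>, of "D 0 1 u 0"]
      by (simp add: pdot_def)
  qed
  define m where "m = boost_pos \<alpha> \<beta> 0 (\<alpha> * (\<beta> * G 0 u)) (\<beta> * - (\<alpha> * F 0 u))"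
  have "((\<lambda>t. binormal u t) has_vector_derivative m) (at 0 within T)"
    unfolding binormal_def m_def by (rule has_vector_derivative_boost_angle)
  from constant_on_imp_derivative_0[OF T_limit[OF \<open>0 \<in> T\<close>] \<open>0 \<in> T\<close> orth has_real_derivative_pdot[OF this d\<xi>]]
  have "pdot m (\<xi> u 0) + pdot (binormal u 0) (D 0 1 u 0) = 0" .
  then have m\<xi>: "pdot m (\<xi> u 0) = 0" using d\<xi>_orth by simp
  \<comment> \<open>In coordinates: \<open>eq2\<close> and \<open>eq4\<close> force \<open>c = d = 0\<close> because \<open>z\<^sub>v\<close> is not null; then \<open>(a, b) \<noteq> 0\<close> is
    parallel to \<open>(f, g)\<close> by \<open>eq1\<close> and orthogonal to \<open>(f', g')\<close> by \<open>eq3\<close>.\<close>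
  define a b c d where "a = \<xi> u 0 $ 1" "b = \<xi> u 0 $ 2" "c = \<xi> u 0 $ 3" "d = \<xi> u 0 $ 4"
  have eq1: "a * G 0 u = b * F 0 u"
    using m\<xi> \<open>\<alpha> \<noteq> 0\<close> \<open>\<beta> \<noteq> 0\<close> by (simp add: m_def boost_pos_def pdot_def a_b_c_d_def algebra_simps)
  have eq2: "G 0 u * \<beta> * c = F 0 u * \<alpha> * d"
    using orth[OF \<open>0 \<in> T\<close>] by (simp add: binormal_def boost_neg_def pdot_def a_b_c_d_def algebra_simps)
  have "\<xi> u 0 \<in> normal_plane J T z u 0"
    using \<xi> \<open>u \<in> J\<close> \<open>0 \<in> T\<close> by (simp add: parallel_normal_field_def normal_field_def)
  then have eq3: "a * F 1 u + b * G 1 u = 0" and eq4: "\<alpha> * F 0 u * c + \<beta> * G 0 u * d = 0"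
    unfolding normal_plane_iff z_1[OF \<open>u \<in> J\<close>] z_2[OF \<open>0 \<in> T\<close>]
    by (simp_all add: boost_pos_def boost_neg_def pdot_def a_b_c_d_def algebra_simps)
  have "(\<alpha>\<^sup>2 * (F 0 u)\<^sup>2 + \<beta>\<^sup>2 * (G 0 u)\<^sup>2) * c
      = \<alpha> * F 0 u * (\<alpha> * F 0 u * c + \<beta> * G 0 u * d) + \<beta> * G 0 u * (G 0 u * \<beta> * c - F 0 u * \<alpha> * d)"
    by (simp add: algebra_simps power2_eq_square)
  moreover have "(\<alpha>\<^sup>2 * (F 0 u)\<^sup>2 + \<beta>\<^sup>2 * (G 0 u)\<^sup>2) * d
      = \<beta> * G 0 u * (\<alpha> * F 0 u * c + \<beta> * G 0 u * d) - \<alpha> * F 0 u * (G 0 u * \<beta> * c - F 0 u * \<alpha> * d)"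
    by (simp add: algebra_simps power2_eq_square)
  ultimately have "c = 0" "d = 0"
    unfolding eq2 eq4 using lorentz[OF \<open>u \<in> J\<close>] by (auto simp del: mult_eq_0_iff simp: mult_eq_0_iff[of "_ + _"])
  moreover have "a\<^sup>2 + b\<^sup>2 - c\<^sup>2 - d\<^sup>2 \<noteq> 0"
    using unit0 by (simp add: pdot_def a_b_c_d_def power2_eq_square)
  ultimately have "a \<noteq> 0 \<or> b \<noteq> 0" by auto
  moreover have "a * (F 0 u * F 1 u + G 0 u * G 1 u)
      = F 0 u * (a * F 1 u + b * G 1 u) + G 1 u * (a * G 0 u - b * F 0 u)"
    "b * (F 0 u * F 1 u + G 0 u * G 1 u)
      = G 0 u * (a * F 1 u + b * G 1 u) - F 1 u * (a * G 0 u - b * F 0 u)"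
    by (simp_all add: algebra_simps)
  ultimately show ?thesis unfolding eq1 eq3 by auto
qed

text \<open>
  On the pseudosphere \<open>\<langle>x, x\<rangle> = C\<^sup>2\<close> the position vector is normal to the surface, and the normal component of
  any boost of \<open>(x, y, 0, 0)\<close> is its component along the position vector. For \<open>z\<^sub>u\<^sub>u\<close> and \<open>z\<^sub>v\<^sub>v\<close> these
  components are \<open>- \<langle>z\<^sub>u, z\<^sub>u\<rangle> z / C\<^sup>2\<close> and \<open>- \<langle>z\<^sub>v, z\<^sub>v\<rangle> z / C\<^sup>2\<close>, whence \<open>H = - z / C\<^sup>2\<close>.
\<close>
lemma circle_imp_parallel:
  assumes circle: "\<And>u. u \<in> J \<Longrightarrow> (F 0 u)\<^sup>2 + (G 0 u)\<^sup>2 = C\<^sup>2" and "C \<noteq> 0"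
  shows "parallel_normalized_mean_curvature J T z"
proof -
  have d1: "F 0 u * F 1 u + G 0 u * G 1 u = 0" if "u \<in> J" for u
  proof -
    have "((\<lambda>s. (F 0 s)\<^sup>2 + (G 0 s)\<^sup>2) has_real_derivative 2 * (F 0 u * F 1 u + G 0 u * G 1 u)) (at u within J)"
      by (rule derivative_eq_intros F_deriv[OF that] G_deriv[OF that] refl)+ (simp add: algebra_simps)
    from constant_on_imp_derivative_0[OF J_limit[OF that] that circle this]
    have "2 * (F 0 u * F 1 u + G 0 u * G 1 u) = 0" .
    then show ?thesis by simp
  qed
  have d2: "F 0 u * F 2 u + G 0 u * G 2 u = - ((F 1 u)\<^sup>2 + (G 1 u)\<^sup>2)" if "u \<in> J" for u
  proof -
    have "((\<lambda>s. F 0 s * F 1 s + G 0 s * G 1 s) has_real_derivative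
        F 0 u * F 2 u + G 0 u * G 2 u + ((F 1 u)\<^sup>2 + (G 1 u)\<^sup>2)) (at u within J)"
      by (rule derivative_eq_intros F_deriv[OF that] G_deriv[OF that] refl)+
         (simp add: algebra_simps power2_eq_square numeral_2_eq_2)
    from constant_on_imp_derivative_0[OF J_limit[OF that] that d1 this]
    have "F 0 u * F 2 u + G 0 u * G 2 u + ((F 1 u)\<^sup>2 + (G 1 u)\<^sup>2) = 0" .
    then show ?thesis by simp
  qed
  have z_normal: "z u v \<in> normal_plane J T z u v" if "u \<in> J" "v \<in> T" for u v
    using that d1 by (simp add: normal_plane_iff z_1 z_2 pdot_boost)
  have H: "mean_curvature_vector J T z u v = (- 1 / C\<^sup>2) *\<^sub>R z u v" if u: "u \<in> J" and v: "v \<in> T" for u v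
  proof -
    define E K where "E = (F 1 u)\<^sup>2 + (G 1 u)\<^sup>2" and "K = \<alpha>\<^sup>2 * (F 0 u)\<^sup>2 + \<beta>\<^sup>2 * (G 0 u)\<^sup>2"
    have EK: "E > 0" "K > 0" using regular lorentz u by (auto simp: E_def K_def)
    \<comment> \<open>On a circle the velocity is the position turned by a right angle, times the angular speed \<open>k\<close>.\<close>
    obtain k where k: "F 1 u = - (k * G 0 u)" "G 1 u = k * F 0 u"
    proof
      show "F 1 u = - ((F 0 u * G 1 u - G 0 u * F 1 u) / C\<^sup>2 * G 0 u)"
        "G 1 u = (F 0 u * G 1 u - G 0 u * F 1 u) / C\<^sup>2 * F 0 u"
        using d1[OF u] circle[OF u] \<open>C \<noteq> 0\<close> by (simp_all add: field_simps) algebra+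
    qed
    have E: "E = k\<^sup>2 * C\<^sup>2" unfolding E_def k circle[OF u, symmetric] by (simp add: algebra_simps power2_eq_square)
    have "k \<noteq> 0" using E EK by auto
    have "normal_part J T z u v (boost_pos \<alpha> \<beta> v x y) = ((x * F 0 u + y * G 0 u) / C\<^sup>2) *\<^sub>R z u v" for x y
    proof (rule normal_part_eqI[OF nondegenerate[OF u v]])
      show "((x * F 0 u + y * G 0 u) / C\<^sup>2) *\<^sub>R z u v \<in> normal_plane J T z u v"
        using z_normal[OF u v] by (simp add: normal_plane_iff pdot_scaleR_left)
      have "boost_pos \<alpha> \<beta> v x y - ((x * F 0 u + y * G 0 u) / C\<^sup>2) *\<^sub>R z u v
         = ((y * F 0 u - x * G 0 u) / (k * C\<^sup>2)) *\<^sub>R pd1 J z u v + 0 *\<^sub>R pd2 T z u v"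
      proof -
        have "x - ((x * F 0 u + y * G 0 u) / C\<^sup>2) * F 0 u = (y * F 0 u - x * G 0 u) / (k * C\<^sup>2) * F 1 u"
          "y - ((x * F 0 u + y * G 0 u) / C\<^sup>2) * G 0 u = (y * F 0 u - x * G 0 u) / (k * C\<^sup>2) * G 1 u"
          using circle[OF u] \<open>C \<noteq> 0\<close> \<open>k \<noteq> 0\<close> unfolding k
          by (simp_all add: field_simps) algebra+
        then show ?thesis
          by (simp add: z_1[OF u] boost_pos_scaleR boost_pos_diff)
      qed
      then show "boost_pos \<alpha> \<beta> v x y - ((x * F 0 u + y * G 0 u) / C\<^sup>2) *\<^sub>R z u v \<in> tangent_plane J T z u v"
        unfolding tangent_plane_iff by blast
    qed
    then have "sff_11 J T z u v = (- E / C\<^sup>2) *\<^sub>R z u v" "sff_22 J T z u v = (K / C\<^sup>2) *\<^sub>R z u v"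
      using d2[OF u]
      by (simp_all add: sff_11_def sff_22_def z_11[OF u] z_22[OF v] E_def K_def power2_eq_square algebra_simps)
    moreover have "fff_E J z u v = E" "fff_F J T z u v = 0" "fff_G T z u v = - K"
      using first_fundamental_form[OF u v] by (simp_all add: E_def K_def)
    ultimately have "mean_curvature_vector J T z u v
        = (1 / 2 * (1 / (E * - K - 0\<^sup>2) * (- K * (- E / C\<^sup>2) + E * (K / C\<^sup>2)))) *\<^sub>R z u v"
      by (simp only: mean_curvature_vector_def scaleR_scaleR mult_zero_right scaleR_zero_left diff_zero
          flip: scaleR_left_distrib)
    also have "1 / 2 * (1 / (E * - K - 0\<^sup>2) * (- K * (- E / C\<^sup>2) + E * (K / C\<^sup>2))) = - 1 / C\<^sup>2"
      using EK \<open>C \<noteq> 0\<close> by (simp add: field_simps)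
    finally show ?thesis .
  qed
  define \<xi> where "\<xi> = (\<lambda>u v. boost_pos \<alpha> \<beta> v (F 0 u / C) (G 0 u / C))"
  have \<xi>_eq: "\<xi> u v = (1 / C) *\<^sub>R z u v" for u v
    by (simp add: \<xi>_def boost_pos_scaleR)
  have "smooth2 J T \<xi>"
    unfolding \<xi>_def using smooth2_boost[of J "\<lambda>n u. F n u / C" "\<lambda>n u. G n u / C"]
    by (simp add: F_deriv G_deriv DERIV_cdivide)
  moreover have "\<xi> u v \<in> normal_plane J T z u v" if "u \<in> J" "v \<in> T" for u v
    using z_normal[OF that] by (simp add: \<xi>_eq normal_plane_iff pdot_scaleR_left)
  moreover have "normal_part J T z u v (pd1 J \<xi> u v) = 0" if "u \<in> J" "v \<in> T" for u v
  proof (rule normal_part_tangent[OF nondegenerate[OF that]])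
    have "pd1 J \<xi> u v = (1 / C) *\<^sub>R pd1 J z u v"
      unfolding \<xi>_def using pd1_boost[OF \<open>u \<in> J\<close>, of "\<lambda>u. F 0 u / C" "F 1 u / C" "\<lambda>u. G 0 u / C" "G 1 u / C"]
        F_deriv[OF \<open>u \<in> J\<close>, of 0] G_deriv[OF \<open>u \<in> J\<close>, of 0]
      by (simp add: z_1[OF \<open>u \<in> J\<close>] boost_pos_scaleR DERIV_cdivide)
    then show "pd1 J \<xi> u v \<in> tangent_plane J T z u v"
      by (simp add: tangent_plane_def span_scale span_base)
  qed
  moreover have "normal_part J T z u v (pd2 T \<xi> u v) = 0" if "u \<in> J" "v \<in> T" for u v
  proof (rule normal_part_tangent[OF nondegenerate[OF that]])
    have "pd2 T \<xi> u v = (1 / C) *\<^sub>R pd2 T z u v"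
      unfolding \<xi>_def pd2_boost[OF \<open>v \<in> T\<close>] by (simp add: boost_neg_scaleR)
    then show "pd2 T \<xi> u v \<in> tangent_plane J T z u v"
      by (simp add: tangent_plane_def span_scale span_base)
  qed
  ultimately have par: "parallel_normal_field J T z \<xi>"
    unfolding parallel_normal_field_def normal_field_def by blast
  have unit: "pdot (\<xi> u v) (\<xi> u v) = 1" if "u \<in> J" for u v
    using circle[OF that] \<open>C \<noteq> 0\<close>
    by (simp add: \<xi>_def pdot_boost power2_eq_square flip: add_divide_distrib)
  have dir: "mean_curvature_vector J T z u v = (- 1 / C) *\<^sub>R \<xi> u v" if "u \<in> J" "v \<in> T" for u v
    using H[OF that] by (simp add: \<xi>_eq power2_eq_square)
  then have "\<exists>c. mean_curvature_vector J T z u v = c *\<^sub>R \<xi> u v" if "u \<in> J" "v \<in> T" for u v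
    using that by blast
  moreover note par unit
  moreover have "mean_curvature_vector J T z u v \<noteq> 0" if "u \<in> J" "v \<in> T" for u v
  proof
    assume "mean_curvature_vector J T z u v = 0"
    then have "\<xi> u v = 0"
      using dir[OF that] \<open>C \<noteq> 0\<close> by simp
    then show False using unit[OF that(1), of v] by (simp add: pdot_def)
  qed
  ultimately show ?thesis
    unfolding parallel_normalized_mean_curvature_def by (intro conjI exI[of _ \<xi>] bexI[of _ 1]) auto
qed

end

section \<open>Circular meridians\<close>

lemma meridian_determined_imp_circle:
  assumes "meridian_determined_by J f g C" "u \<in> J"
  shows "(f u)\<^sup>2 + (g u)\<^sup>2 = C\<^sup>2"
proof -
  have "(f u, g u) \<in> (\<Union>\<epsilon>\<in>{1, -1}. (\<lambda>s. (\<epsilon> * sqrt (C\<^sup>2 - s\<^sup>2), s)) ` {-\<bar>C\<bar>..\<bar>C\<bar>})"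
    using assms unfolding meridian_determined_by_def by blast
  then obtain \<epsilon> s where "\<epsilon> \<in> {1, - 1 :: real}" "s \<in> {-\<bar>C\<bar>..\<bar>C\<bar>}" "f u = \<epsilon> * sqrt (C\<^sup>2 - s\<^sup>2)" "g u = s"
    by blast
  moreover from this have "s\<^sup>2 \<le> C\<^sup>2"
    by (intro iffD1[OF abs_le_square_iff]) auto
  ultimately show ?thesis by (auto simp: power_mult_distrib)
qed

text \<open>
  The new parameter is \<open>g\<close> itself: on an interval without zeros of \<open>f\<close> the sign of \<open>f\<close> is constant, so the
  curve stays on one branch, and \<open>g\<close> is regular there.
\<close>
lemma circle_imp_meridian_determined:
  assumes f: "smooth1 J f" and g: "smooth1 J g"
    and circle: "\<And>u. u \<in> J \<Longrightarrow> (f u)\<^sup>2 + (g u)\<^sup>2 = C\<^sup>2"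
    and turn: "\<And>u. u \<in> J \<Longrightarrow> f u \<noteq> 0 \<Longrightarrow> vector_derivative g (at u within J) \<noteq> 0"
  shows "meridian_determined_by J f g C"
  unfolding meridian_determined_by_def
proof (intro conjI allI impI)
  have branch: "\<bar>f u\<bar> = sqrt (C\<^sup>2 - (g u)\<^sup>2)" if "u \<in> J" for u
  proof -
    have "C\<^sup>2 - (g u)\<^sup>2 = (f u)\<^sup>2" using circle[OF that] by simp
    then show ?thesis by simp
  qed
  have le: "\<bar>g u\<bar> \<le> \<bar>C\<bar>" if "u \<in> J" for u
    using circle[OF that] by (simp add: abs_le_square_iff) (metis le_add_same_cancel2 zero_le_power2)
  show "(\<lambda>u. (f u, g u)) ` J \<subseteq>
       (\<Union>\<epsilon>\<in>{1, -1}. (\<lambda>s. (\<epsilon> * sqrt (C\<^sup>2 - s\<^sup>2), s)) ` {-\<bar>C\<bar>..\<bar>C\<bar>})"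
  proof clarify
    fix u assume u: "u \<in> J"
    have "f u = (if f u \<ge> 0 then 1 else -1) * sqrt (C\<^sup>2 - (g u)\<^sup>2)"
      using branch[OF u] by (auto simp: abs_if split: if_splits)
    moreover have "g u \<in> {-\<bar>C\<bar>..\<bar>C\<bar>}" using le[OF u] by (auto simp: abs_le_iff)
    ultimately show "(f u, g u) \<in> (\<Union>\<epsilon>\<in>{1, -1}. (\<lambda>s. (\<epsilon> * sqrt (C\<^sup>2 - s\<^sup>2), s)) ` {-\<bar>C\<bar>..\<bar>C\<bar>})"
      by (intro UN_I[of "if f u \<ge> 0 then 1 else -1"] image_eqI[of _ _ "g u"]) auto
  qed
  fix K assume K: "is_interval K \<and> interior K \<noteq> {} \<and> K \<subseteq> J \<and> (\<forall>u\<in>K. f u \<noteq> 0)"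
  then have "K \<subseteq> J" and nz: "\<And>u. u \<in> K \<Longrightarrow> f u \<noteq> 0" and conn: "connected K"
    by (auto simp: is_interval_connected)
  obtain Df where Df: "Df 0 = f" "\<And>n u. u \<in> J \<Longrightarrow> (Df n has_vector_derivative Df (Suc n) u) (at u within J)"
    using f unfolding smooth1_def by blast
  obtain Dg where Dg: "Dg 0 = g" "\<And>n u. u \<in> J \<Longrightarrow> (Dg n has_vector_derivative Dg (Suc n) u) (at u within J)"
    using g unfolding smooth1_def by blast
  have smooth: "smooth1 K g"
    unfolding smooth1_def
    using Dg \<open>K \<subseteq> J\<close> by (blast intro: has_vector_derivative_within_subset)
  have turnK: "vector_derivative g (at u within K) \<noteq> 0" if "u \<in> K" for u
  proof -
    have lim: "at u within K \<noteq> bot"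
      using at_within_connected_neq_bot conn K that by blast
    moreover from lim have "at u within J \<noteq> bot"
      using \<open>K \<subseteq> J\<close> at_le bot.extremum_uniqueI by metis
    moreover have "(g has_vector_derivative Dg 1 u) (at u within J)"
      using Dg(2)[of u 0] Dg(1) that \<open>K \<subseteq> J\<close> by auto
    ultimately have "vector_derivative g (at u within K) = vector_derivative g (at u within J)"
      using vector_derivative_within has_vector_derivative_within_subset \<open>K \<subseteq> J\<close> by metis
    then show ?thesis using turn nz that \<open>K \<subseteq> J\<close> by auto
  qed
  have cont: "continuous_on K f"
    using Df(2)[of _ 0] Df(1) \<open>K \<subseteq> J\<close> continuous_on_vector_derivative[of J f] continuous_on_subset by metis
  have "\<exists>\<epsilon>\<in>{1, -1::real}. \<forall>u\<in>K. f u = \<epsilon> * \<bar>f u\<bar>"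
  proof -
    have "(\<forall>u\<in>K. f u > 0) \<or> (\<forall>u\<in>K. f u < 0)"
    proof (rule ccontr)
      assume "\<not> ?thesis"
      then obtain a b where "a \<in> K" "b \<in> K" "f a \<le> 0" "0 \<le> f b" by force
      moreover have "is_interval (f ` K)"
        using conn cont by (simp add: is_interval_connected_1 connected_continuous_image)
      ultimately have "0 \<in> f ` K"
        unfolding is_interval_1 by blast
      then show False using nz by auto
    qed
    then show ?thesis
    proof
      assume "\<forall>u\<in>K. f u > 0"
      then show ?thesis by (intro bexI[of _ 1]) auto
    next
      assume "\<forall>u\<in>K. f u < 0"
      then show ?thesis by (intro bexI[of _ "-1"]) auto
    qed
  qed
  then obtain \<epsilon> :: real where \<epsilon>: "\<epsilon> \<in> {1, -1}" "\<And>u. u \<in> K \<Longrightarrow> f u = \<epsilon> * \<bar>f u\<bar>" by blast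
  have "g u \<in> {-\<bar>C\<bar><..<\<bar>C\<bar>}" if "u \<in> K" for u
  proof -
    have "(g u)\<^sup>2 < C\<^sup>2" using circle[of u] nz[OF that] that \<open>K \<subseteq> J\<close> by (smt (verit) subsetD zero_less_power2)
    then have "\<bar>g u\<bar> < \<bar>C\<bar>" by (meson abs_le_square_iff not_le)
    then show ?thesis by auto
  qed
  then have "reparametrizes K f g {-\<bar>C\<bar><..<\<bar>C\<bar>} (\<lambda>s. \<epsilon> * sqrt (C\<^sup>2 - s\<^sup>2)) (\<lambda>s. s)"
    unfolding reparametrizes_def
    using smooth turnK \<epsilon>(2) branch \<open>K \<subseteq> J\<close>
    by (intro exI[of _ g]) (auto, metis subsetD)
  then show "\<exists>\<epsilon>\<in>{1, -1}. reparametrizes K f g {-\<bar>C\<bar><..<\<bar>C\<bar>} (\<lambda>s. \<epsilon> * sqrt (C\<^sup>2 - s\<^sup>2)) (\<lambda>s. s)"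
    using \<epsilon>(1) by blast
qed

theorem theorem5p3:
  fixes J :: "real set" and \<alpha> \<beta> :: real and f g :: "real \<Rightarrow> real"
  assumes "is_interval J" and "interior J \<noteq> {}"
    and "\<alpha> > 0" and "\<beta> > 0"
    and "smooth1 J f" and "smooth1 J g"
    and "\<And>u. u \<in> J \<Longrightarrow> \<alpha>\<^sup>2 * (f u)\<^sup>2 + \<beta>\<^sup>2 * (g u)\<^sup>2 > 0"
    and "\<And>u. u \<in> J \<Longrightarrow>
      (vector_derivative f (at u within J))\<^sup>2 + (vector_derivative g (at u within J))\<^sup>2 > 0"
  shows "parallel_normalized_mean_curvature J {0..<2 * pi} (hyperbolic_rotational_surface \<alpha> \<beta> f g)
    \<longleftrightarrow> (\<exists>C. C \<noteq> 0 \<and> meridian_determined_by J f g C)"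
proof -
  obtain F where F: "F 0 = f" "\<And>n u. u \<in> J \<Longrightarrow> (F n has_real_derivative F (Suc n) u) (at u within J)"
    using assms(5) unfolding smooth1_def has_real_derivative_iff_has_vector_derivative by blast
  obtain G where G: "G 0 = g" "\<And>n u. u \<in> J \<Longrightarrow> (G n has_real_derivative G (Suc n) u) (at u within J)"
    using assms(6) unfolding smooth1_def has_real_derivative_iff_has_vector_derivative by blast
  have J_limit: "at u within J \<noteq> bot" if "u \<in> J" for u
    using at_within_connected_neq_bot[OF is_interval_connected] assms(1,2) that by blast
  have f': "vector_derivative f (at u within J) = F 1 u" if "u \<in> J" for u
    using vector_derivative_within[OF J_limit[OF that]] F(2)[OF that, of 0] F(1)
    by (simp add: has_real_derivative_iff_has_vector_derivative)
  have g': "vector_derivative g (at u within J) = G 1 u" if "u \<in> J" for u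
    using vector_derivative_within[OF J_limit[OF that]] G(2)[OF that, of 0] G(1)
    by (simp add: has_real_derivative_iff_has_vector_derivative)
  let ?T = "{0..<2 * pi}"
  have T_limit: "at v within ?T \<noteq> bot" if "v \<in> ?T" for v
    using that pi_gt_zero by (intro at_within_connected_neq_bot) auto
  interpret rotational_meridian J ?T \<alpha> \<beta> F G
  proof
    show "0 < (F 1 u)\<^sup>2 + (G 1 u)\<^sup>2" if "u \<in> J" for u
      using assms(8)[OF that] that by (simp add: f' g')
  qed (use assms(7) F G J_limit T_limit in auto)
  have surf: "hyperbolic_rotational_surface \<alpha> \<beta> f g = z"
    by (simp add: hyperbolic_rotational_surface_eq_boost F(1) G(1))
  show ?thesis
    unfolding surf
  proof
    assume par: "parallel_normalized_mean_curvature J ?T z"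
    have stat: "f u * F 1 u + g u * G 1 u = 0" if "u \<in> J" for u
      using parallel_imp_radius_stationary[OF par _ that] assms(3,4) F(1) G(1) by simp
    have "\<exists>c. \<forall>u\<in>J. (f u)\<^sup>2 + (g u)\<^sup>2 = c"
    proof (rule has_field_derivative_zero_constant)
      show "convex J" using assms(1) by (rule is_interval_convex)
      fix u assume u: "u \<in> J"
      have "(f has_real_derivative F 1 u) (at u within J)" "(g has_real_derivative G 1 u) (at u within J)"
        using F(2)[OF u, of 0] G(2)[OF u, of 0] F(1) G(1) by simp_all
      then have "((\<lambda>u. (f u)\<^sup>2 + (g u)\<^sup>2) has_real_derivative 2 * (f u * F 1 u + g u * G 1 u)) (at u within J)"
        by (auto intro!: derivative_eq_intros simp: algebra_simps)
      then show "((\<lambda>u. (f u)\<^sup>2 + (g u)\<^sup>2) has_real_derivative 0) (at u within J)"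
        unfolding stat[OF u] by simp
    qed
    then obtain c where c: "\<And>u. u \<in> J \<Longrightarrow> (f u)\<^sup>2 + (g u)\<^sup>2 = c" by blast
    obtain u0 where u0: "u0 \<in> J" using assms(2) interior_subset by blast
    have "c > 0"
    proof -
      have "f u0 \<noteq> 0 \<or> g u0 \<noteq> 0" using assms(7)[OF u0] by auto
      then show ?thesis using c[OF u0] by (auto simp: sum_power2_gt_zero_iff)
    qed
    have "meridian_determined_by J f g (sqrt c)"
    proof (rule circle_imp_meridian_determined)
      show "(f u)\<^sup>2 + (g u)\<^sup>2 = (sqrt c)\<^sup>2" if "u \<in> J" for u
        using c[OF that] \<open>c > 0\<close> by simp
      show "vector_derivative g (at u within J) \<noteq> 0" if "u \<in> J" "f u \<noteq> 0" for u
        using stat[OF that(1)] regular[OF that(1)] that by (auto simp: g')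
    qed (use assms in auto)
    then show "\<exists>C. C \<noteq> 0 \<and> meridian_determined_by J f g C"
      using \<open>c > 0\<close> by (intro exI[of _ "sqrt c"]) simp
  next
    assume "\<exists>C. C \<noteq> 0 \<and> meridian_determined_by J f g C"
    then show "parallel_normalized_mean_curvature J ?T z"
      using circle_imp_parallel meridian_determined_imp_circle F(1) G(1) by metis
  qed
qed

end
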